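(* Given seven lines in $\mathbb{CP}^3$ (in general position subject to the following incidences) which are combinatorially attached to seven vertices of an elementary cube and intersect each other "along edges" (that is, any two of the lines attached to vertices joined by an edge of the cube intersect), there exists a unique eighth line, attached to the remaining vertex, such that the eight lines constitute an elementary cube of a fundamental line complex.
   Context: An elementary cube has vertices labelled by the subsets of $\{1,2,3\}$, two vertices being joined by an edge if the subsets differ by exactly one element. The lines attached to the vertices are denoted by $\mathsf{l},\mathsf{l}_1,\mathsf{l}_2,\mathsf{l}_3,\mathsf{l}_{12},\mathsf{l}_{13},\mathsf{l}_{23},\mathsf{l}_{123}$, the lower indices (whose order is irrelevant) listing the elements of the subset. Eight lines constitute an elementary cube of a fundamental line complex in $\mathbb{CP}^3$ if any two lines attached to vertices joined by an edge intersect and the points of intersection $$\mathsf{p}^l=\mathsf{l}\cap\mathsf{l}_l,\quad \mathsf{p}^l_m=\mathsf{l}_m\cap\mathsf{l}_{lm},\quad \mathsf{p}^l_{mp}=\mathsf{l}_{mp}\cap\mathsf{l}_{lmp}$$ enjoy the coplanarity property: for any distinct $l,m,p\in\{1,2,3\}$, the four points $\mathsf{p}^l,\mathsf{p}^l_m,\mathsf{p}^l_{mp},\mathsf{p}^l_p$ are coplanar. (Generically, this is equivalent to the concurrency property: for any distinct $l,m,p$, the four lines connecting the points $\mathsf{p}^l,\mathsf{p}^p,\mathsf{p}^l_p,\mathsf{p}^p_l$ with their shifted counterparts $\mathsf{p}^l_m,\mathsf{p}^p_m,\mathsf{p}^l_{pm},\mathsf{p}^p_{lm}$, respectively, are concurrent.)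 Standing genericity: the given lines are assumed to be in general position subject to the required incidences. In particular, lines attached to vertices joined by an edge are distinct and meet in one point; the points of intersection on a given line attached to different edges are distinct; lines attached to vertices which are not joined by an edge are skew; the three points attached to the three edges of the same direction among the nine given edges are not collinear and span a plane which does not contain the remaining given line through which the fourth edge of this direction passes. *)

theory Defs
  imports "HOL-Analysis.Analysis"
begin

text \<open>
  Points, lines and planes of $CP^3$ are the complex linear subspaces of $C^4$ of dimension
  1, 2 and 3. Incidence is inclusion, and projective intersection is set intersection: two
  flats are disjoint in $CP^3$ iff their intersection is the zero subspace.
\<close>

definition proj_point :: "(complex^4) set \<Rightarrow> bool" where
  "proj_point P \<longleftrightarrow> vec.subspace P \<and> vec.dim P = 1"

definition proj_line :: "(complex^4) set \<Rightarrow> bool" where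
  "proj_line K \<longleftrightarrow> vec.subspace K \<and> vec.dim K = 2"

definition proj_plane :: "(complex^4) set \<Rightarrow> bool" where
  "proj_plane E \<longleftrightarrow> vec.subspace E \<and> vec.dim E = 3"

definition proj_collinear :: "(complex^4) set set \<Rightarrow> bool" where
  "proj_collinear X \<longleftrightarrow> (\<exists>K. proj_line K \<and> (\<forall>P\<in>X. P \<subseteq> K))"

definition proj_coplanar :: "(complex^4) set set \<Rightarrow> bool" where
  "proj_coplanar X \<longleftrightarrow> (\<exists>E. proj_plane E \<and> (\<forall>P\<in>X. P \<subseteq> E))"

definition proj_intersect :: "(complex^4) set \<Rightarrow> (complex^4) set \<Rightarrow> bool" where
  "proj_intersect K M \<longleftrightarrow> (\<exists>P. proj_point P \<and> P \<subseteq> K \<and> P \<subseteq> M)"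

definition proj_skew :: "(complex^4) set \<Rightarrow> (complex^4) set \<Rightarrow> bool" where
  "proj_skew K M \<longleftrightarrow> \<not> proj_intersect K M"

abbreviation cube_vertices :: "nat set set" where
  "cube_vertices \<equiv> Pow {1, 2, 3}"

definition cube_edge :: "nat set \<Rightarrow> nat set \<Rightarrow> bool" where
  "cube_edge A B \<longleftrightarrow>
     A \<in> cube_vertices \<and> B \<in> cube_vertices \<and> card ((A - B) \<union> (B - A)) = 1"

text \<open>
  For \<open>i \<notin> S\<close>, \<open>edge_pt L i S\<close> is the point $p^i_S$ on the edge of direction \<open>i\<close> that joins
  \<open>S\<close> to \<open>S \<union> {i}\<close>.
\<close>

definition edge_pt :: "(nat set \<Rightarrow> (complex^4) set) \<Rightarrow> nat \<Rightarrow> nat set \<Rightarrow> (complex^4) set" where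
  "edge_pt L i S = L S \<inter> L (insert i S)"

definition fundamental_cube :: "(nat set \<Rightarrow> (complex^4) set) \<Rightarrow> bool" where
  "fundamental_cube L \<longleftrightarrow>
     (\<forall>A\<in>cube_vertices. proj_line (L A)) \<and>
     (\<forall>A B. cube_edge A B \<longrightarrow> proj_point (L A \<inter> L B)) \<and>
     (\<forall>l\<in>{1, 2, 3}. \<forall>m\<in>{1, 2, 3}. \<forall>p\<in>{1, 2, 3}. l \<noteq> m \<and> l \<noteq> p \<and> m \<noteq> p \<longrightarrow>
        proj_coplanar {edge_pt L l {}, edge_pt L l {m}, edge_pt L l {m, p}, edge_pt L l {p}})"

text \<open>
  In what follows \<open>v\<close> is the vertex without a given line; the value \<open>L v\<close> is never used.
  \<open>given_pts L v i\<close> consists of the three points on the edges of direction \<open>i\<close> that avoid \<open>v\<close>,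
  and \<open>opposite_end v i\<close> is the other endpoint of the edge of direction \<open>i\<close> at \<open>v\<close>.
\<close>

definition given_pts :: "(nat set \<Rightarrow> (complex^4) set) \<Rightarrow> nat set \<Rightarrow> nat \<Rightarrow> (complex^4) set set" where
  "given_pts L v i = {edge_pt L i S | S. S \<subseteq> {1, 2, 3} - {i} \<and> S \<noteq> v \<and> insert i S \<noteq> v}"

definition opposite_end :: "nat set \<Rightarrow> nat \<Rightarrow> nat set" where
  "opposite_end v i = (if i \<in> v then v - {i} else insert i v)"

definition general_position :: "(nat set \<Rightarrow> (complex^4) set) \<Rightarrow> nat set \<Rightarrow> bool" where
  "general_position L v \<longleftrightarrow>
     (\<forall>A B. cube_edge A B \<and> A \<noteq> v \<and> B \<noteq> v \<longrightarrow>
        L A \<noteq> L B \<and> proj_point (L A \<inter> L B)) \<and>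
     (\<forall>A B C. cube_edge A B \<and> cube_edge A C \<and> B \<noteq> C \<and> A \<noteq> v \<and> B \<noteq> v \<and> C \<noteq> v \<longrightarrow>
        L A \<inter> L B \<noteq> L A \<inter> L C) \<and>
     (\<forall>A\<in>cube_vertices - {v}. \<forall>B\<in>cube_vertices - {v}. A \<noteq> B \<and> \<not> cube_edge A B \<longrightarrow>
        proj_skew (L A) (L B)) \<and>
     (\<forall>i\<in>{1, 2, 3}. \<not> proj_collinear (given_pts L v i) \<and>
        (\<forall>E. proj_plane E \<and> (\<forall>P\<in>given_pts L v i. P \<subseteq> E) \<longrightarrow> \<not> L (opposite_end v i) \<subseteq> E))"

end

theory Submission
  imports Defs
begin

text \<open>
  Call the missing vertex the origin. Its three neighbours
  carry pairwise skew lines \<open>a\<^sub>1, a\<^sub>2, a\<^sub>3\<close>; the vertices at distance two carry lines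
  \<open>b\<^sub>1, b\<^sub>2, b\<^sub>3\<close>, with \<open>b\<^sub>k\<close> meeting the \<open>a\<^sub>i\<close> for \<open>i \<noteq> k\<close>; the opposite vertex carries a line \<open>c\<close>
  meeting every \<open>b\<^sub>k\<close>.

  Coplanarity in direction \<open>i\<close> leaves no choice: the three given points of that direction span a
  plane that does not contain \<open>a\<^sub>i\<close>, and the eighth line has to pass through the point \<open>p\<^sub>i\<close> where
  this plane cuts \<open>a\<^sub>i\<close>. The points \<open>p\<^sub>1, p\<^sub>2, p\<^sub>3\<close> are distinct because the \<open>a\<^sub>i\<close> are skew, so there is
  at most one such line, and there is one precisely when the three points are collinear
  (\<open>eighth_line_through_fourth_points\<close>).

  That they are always collinear is seen by choosing representing vectors well. Let \<open>q\<^sub>k\<close>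
  represent \<open>c \<inter> b\<^sub>k\<close> and \<open>r\<^sub>i\<^sub>k\<close> represent \<open>a\<^sub>i \<inter> b\<^sub>k\<close>. Collinearity on \<open>c\<close> allows
  \<open>q\<^sub>1 + q\<^sub>2 + q\<^sub>3 = 0\<close>, and collinearity on the \<open>b\<^sub>k\<close> then allows \<open>r\<^sub>2\<^sub>1 = r\<^sub>3\<^sub>1 + q\<^sub>1\<close>,
  \<open>r\<^sub>3\<^sub>2 = r\<^sub>1\<^sub>2 + q\<^sub>2\<close> and \<open>r\<^sub>1\<^sub>3 = r\<^sub>2\<^sub>3 + q\<^sub>3\<close>. Now \<open>r\<^sub>1\<^sub>2 - r\<^sub>1\<^sub>3 = q\<^sub>1 - r\<^sub>2\<^sub>3 + r\<^sub>3\<^sub>2\<close> represents \<open>p\<^sub>1\<close>, and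
  likewise cyclically; these three vectors add up to zero (\<open>fourth_points_sum_to_zero\<close>).

  All vertices of the cube are equivalent under symmetric difference with a fixed set, which
  preserves the directions of edges, so it is enough to treat the missing vertex \<open>{}\<close>.
\<close>

section \<open>Points, lines and planes\<close>

lemma proj_point_span: "x \<noteq> 0 \<Longrightarrow> proj_point (vec.span {x})"
  by (simp add: proj_point_def vec.dim_insert)

lemma proj_point_eq_span:
  assumes "proj_point P" "x \<in> P" "x \<noteq> 0"
  shows "P = vec.span {x}"
proof -
  have "vec.span {x} \<subseteq> P"
    using assms by (simp add: proj_point_def vec.span_minimal)
  then show ?thesis
    using assms proj_point_span[of x] vec.subspace_dim_equal[of "vec.span {x}" P]
    by (simp add: proj_point_def)
qed

lemma proj_point_nonzero:
  assumes "proj_point P"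
  obtains x where "x \<in> P" "x \<noteq> 0"
proof -
  have "\<not> P \<subseteq> {0}"
    using assms vec.dim_subset[of P "{0}"] by (auto simp: proj_point_def)
  then show ?thesis using that by blast
qed

lemma distinct_proj_points_disjoint:
  assumes "proj_point P" "proj_point Q" "P \<noteq> Q" "x \<in> P" "x \<in> Q"
  shows "x = 0"
  using assms proj_point_eq_span by metis

lemma proj_intersectI:
  assumes "vec.subspace K" "vec.subspace M" "x \<in> K" "x \<in> M" "x \<noteq> 0"
  shows "proj_intersect K M"
  unfolding proj_intersect_def
  using assms proj_point_span[of x] by (auto intro!: exI[of _ "vec.span {x}"] dest: vec.span_minimal[of "{x}", rotated])

lemma proj_line_eq_span:
  assumes "proj_line K" "x \<in> K" "y \<in> K" "y \<noteq> 0" "x \<notin> vec.span {y}"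
  shows "K = vec.span {x, y}"
proof -
  have "vec.span {x, y} \<subseteq> K"
    using assms by (simp add: proj_line_def vec.span_minimal)
  moreover have "vec.dim (vec.span {x, y}) = 2"
    using assms by (simp add: vec.dim_insert)
  ultimately show ?thesis
    using assms vec.subspace_dim_equal[of "vec.span {x, y}" K]
    by (simp add: proj_line_def)
qed

text \<open>
  One nonzero common vector thus determines the intersection of a line with another line, or with
  a plane that does not contain it.
\<close>

lemma proper_subspace_of_line:
  assumes "proj_line K" "vec.subspace S" "S \<subseteq> K" "S \<noteq> K" "x \<in> S" "x \<noteq> 0"
  shows "S = vec.span {x}"
proof -
  have "vec.span {x} \<subseteq> S"
    using assms by (simp add: vec.span_minimal)
  moreover have "vec.dim S \<noteq> 2"
    using assms vec.subspace_dim_equal[of S K] by (auto simp: proj_line_def)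
  moreover have "vec.dim S \<le> 2"
    using assms vec.dim_subset[of S K] by (auto simp: proj_line_def)
  ultimately show ?thesis
    using assms vec.subspace_dim_equal[of "vec.span {x}" S] by (simp add: vec.dim_insert)
qed

lemma extend_to_line:
  assumes "vec.dim (S :: (complex^4) set) \<le> 2"
  shows "\<exists>K. proj_line K \<and> S \<subseteq> K"
  using assms
proof (induction "2 - vec.dim S" arbitrary: S)
  case 0
  then show ?case
    by (intro exI[of _ "vec.span S"]) (simp add: proj_line_def vec.span_superset)
next
  case (Suc n)
  have "vec.dim (vec.span S) \<noteq> vec.dim (UNIV :: (complex^4) set)"
    unfolding vec.dim_span vec_dim_card using Suc.prems by simp
  then have "vec.span S \<noteq> UNIV" by metis
  then obtain x where "x \<notin> vec.span S" by blast
  then have "vec.dim (insert x S) = vec.dim S + 1"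
    by (simp add: vec.dim_insert)
  then have "\<exists>K. proj_line K \<and> insert x S \<subseteq> K"
    using Suc by (intro Suc.hyps(1)) auto
  then show ?case by blast
qed

text \<open>
  If the three representing vectors spanned less than three dimensions, their span would extend
  to a line through the three points; hence their span is already the plane.
\<close>

lemma unique_plane:
  assumes "proj_point P" "proj_point Q" "proj_point R" "\<not> proj_collinear {P, Q, R}"
  shows "\<exists>!E. proj_plane E \<and> (\<forall>X\<in>{P, Q, R}. X \<subseteq> E)"
proof -
  obtain x y z where "x \<in> P" "x \<noteq> 0" "y \<in> Q" "y \<noteq> 0" "z \<in> R" "z \<noteq> 0"
    using assms proj_point_nonzero by metis
  then have eqs: "P = vec.span {x}" "Q = vec.span {y}" "R = vec.span {z}"
    using assms proj_point_eq_span by auto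
  have in_iff: "(\<forall>X\<in>{P, Q, R}. X \<subseteq> E) \<longleftrightarrow> {x, y, z} \<subseteq> E" if "vec.subspace E" for E
    using that eqs vec.span_minimal[of _ E] vec.span_superset by (auto dest: vec.span_base) blast+
  have "\<not> vec.dim {x, y, z} \<le> 2"
    using assms(4) extend_to_line in_iff unfolding proj_collinear_def proj_line_def by metis
  moreover have "vec.dim {x, y, z} \<le> 3"
    by (rule order.trans[OF vec.dim_le_card'])  (auto simp: card_insert_if)
  ultimately have dim: "vec.dim (vec.span {x, y, z}) = 3"
    by simp
  have "E = vec.span {x, y, z}" if "proj_plane E" "{x, y, z} \<subseteq> E" for E
    using that dim vec.subspace_dim_equal[of "vec.span {x, y, z}" E] vec.span_minimal[of _ E]
    by (simp add: proj_plane_def)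
  then show ?thesis
    using dim in_iff vec.span_superset[of "{x, y, z}"]
    by (intro ex1I[of _ "vec.span {x, y, z}"]) (auto simp: proj_plane_def)
qed

text \<open>
  A choice of homogeneous coordinates: any two of three distinct collinear points are a basis of
  the line, and the coordinates of the third point in it can be absorbed into the vectors that
  represent the two. A given representative of one point thus becomes the difference of
  representatives of the other two.
\<close>

lemma scale_collinear_points:
  assumes K: "proj_line K" and points: "proj_point P" "proj_point Q" "proj_point R"
    and on: "P \<subseteq> K" "Q \<subseteq> K" "R \<subseteq> K" and distinct: "P \<noteq> Q" "P \<noteq> R" "Q \<noteq> R"
    and q: "q \<in> Q" "q \<noteq> 0"
  obtains p r where "p \<in> P" "r \<in> R" "p \<noteq> 0" "r \<noteq> 0" "r = p + q"
proof -
  obtain x z where xz: "x \<in> P" "x \<noteq> 0" "z \<in> R" "z \<noteq> 0"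
    using points proj_point_nonzero by metis
  have PR: "P = vec.span {x}" "R = vec.span {z}"
    using points xz proj_point_eq_span by auto
  have "x \<notin> R"
    using distinct_proj_points_disjoint points distinct xz by metis
  then have "K = vec.span {x, z}"
    using xz on K PR by (intro proj_line_eq_span) auto
  then obtain \<alpha> where "q - \<alpha> *s x \<in> R"
    using q on PR vec.span_breakdown_eq[of q x "{z}"] by auto
  moreover have "(- \<alpha>) *s x \<in> P"
    using PR by (meson vec.span_base vec.span_scale singletonI)
  moreover have "q - \<alpha> *s x = (- \<alpha>) *s x + q"
    by simp
  ultimately obtain p r where pr: "p \<in> P" "r \<in> R" "r = p + q"
    by blast
  moreover have "p \<noteq> 0"
    using pr q distinct_proj_points_disjoint[of Q R q] points distinct by auto
  moreover have "r \<noteq> 0"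
  proof
    assume "r = 0"
    then have "q = (- 1) *s p" using pr by (simp add: add_eq_0_iff)
    then have "q \<in> P" using pr PR by (simp only: vec.span_scale)
    then show False
      using q distinct_proj_points_disjoint[of P Q q] points distinct by auto
  qed
  ultimately show ?thesis using that by blast
qed

section \<open>The line through the fourth points\<close>

text \<open>
  The heart of the matter. With indices written as in \<open>r\<^sub>j\<^sub>k\<close> for the point where \<open>a\<^sub>j\<close> meets \<open>b\<^sub>k\<close>, first
  scale the three points of \<open>c\<close> so that \<open>q\<^sub>1 + q\<^sub>2 + q\<^sub>3 = 0\<close>, and then the two remaining points of
  each \<open>b\<^sub>k\<close> so that their difference is \<open>q\<^sub>k\<close>, with cyclically consistent signs. Every vector
  representing a given point is then fixed, and \<open>p\<^sub>i = r\<^sub>i\<^sub>j - r\<^sub>i\<^sub>k\<close> for cyclic \<open>(i, j, k)\<close> can be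
  rewritten as \<open>q\<^sub>i - r\<^sub>j\<^sub>k + r\<^sub>k\<^sub>j\<close>; the first form shows that it lies on \<open>a\<^sub>i\<close>, the second that it
  lies in the plane of the three given points of direction \<open>i\<close>. The sum of the \<open>p\<^sub>i\<close> telescopes to
  \<open>- (q\<^sub>1 + q\<^sub>2 + q\<^sub>3)\<close>.
\<close>

lemma fourth_points_sum_to_zero:
  assumes lines: "proj_line c" "proj_line b1" "proj_line b2" "proj_line b3"
      "proj_line a1" "proj_line a2" "proj_line a3"
    and points: "proj_point (b1 \<inter> c)" "proj_point (b2 \<inter> c)" "proj_point (b3 \<inter> c)"
      "proj_point (a1 \<inter> b2)" "proj_point (a1 \<inter> b3)" "proj_point (a2 \<inter> b1)"
      "proj_point (a2 \<inter> b3)" "proj_point (a3 \<inter> b1)" "proj_point (a3 \<inter> b2)"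
    and on_c: "b1 \<inter> c \<noteq> b2 \<inter> c" "b1 \<inter> c \<noteq> b3 \<inter> c" "b2 \<inter> c \<noteq> b3 \<inter> c"
    and on_b1: "b1 \<inter> c \<noteq> a2 \<inter> b1" "b1 \<inter> c \<noteq> a3 \<inter> b1" "a2 \<inter> b1 \<noteq> a3 \<inter> b1"
    and on_b2: "b2 \<inter> c \<noteq> a1 \<inter> b2" "b2 \<inter> c \<noteq> a3 \<inter> b2" "a1 \<inter> b2 \<noteq> a3 \<inter> b2"
    and on_b3: "b3 \<inter> c \<noteq> a1 \<inter> b3" "b3 \<inter> c \<noteq> a2 \<inter> b3" "a1 \<inter> b3 \<noteq> a2 \<inter> b3"
    and on_a: "a1 \<inter> b2 \<noteq> a1 \<inter> b3" "a2 \<inter> b1 \<noteq> a2 \<inter> b3" "a3 \<inter> b1 \<noteq> a3 \<inter> b2"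
  obtains p1 p2 p3 where "p1 + p2 + p3 = 0"
    "p1 \<in> a1" "p1 \<noteq> 0" "p1 \<in> vec.span ((b1 \<inter> c) \<union> (a2 \<inter> b3) \<union> (a3 \<inter> b2))"
    "p2 \<in> a2" "p2 \<noteq> 0" "p2 \<in> vec.span ((b2 \<inter> c) \<union> (a1 \<inter> b3) \<union> (a3 \<inter> b1))"
    "p3 \<in> a3" "p3 \<noteq> 0" "p3 \<in> vec.span ((b3 \<inter> c) \<union> (a1 \<inter> b2) \<union> (a2 \<inter> b1))"
proof -
  obtain q1 where q1: "q1 \<in> b1 \<inter> c" "q1 \<noteq> 0"
    using points(1) proj_point_nonzero by blast
  obtain q2 q3' where q23: "q2 \<in> b2 \<inter> c" "q3' \<in> b3 \<inter> c" "q2 \<noteq> 0" "q3' \<noteq> 0" "q3' = q2 + q1"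
    using scale_collinear_points[OF lines(1) points(2,1,3) _ _ _ _ _ _ q1] on_c by blast
  \<comment> \<open>The scaling lemma yields a difference; the sign makes the relation on \<open>c\<close> symmetric.\<close>
  define q3 where "q3 = - q3'"
  have q3: "q3 \<in> b3 \<inter> c" "q3 \<noteq> 0" "q1 + q2 + q3 = 0"
  proof -
    show "q3 \<in> b3 \<inter> c"
      using q23(2) points(3) vec.subspace_neg unfolding q3_def proj_point_def by blast
    show "q3 \<noteq> 0" using q23(4) by (simp add: q3_def)
    show "q1 + q2 + q3 = 0" using q23(5) by (simp add: q3_def)
  qed
  \<comment> \<open>The point from which \<open>q\<^sub>k\<close> leads to the other one is chosen cyclically in \<open>k\<close>: this is what
    makes the sum of the three fourth points telescope.\<close>
  obtain r31 r21 where r1: "r31 \<in> a3 \<inter> b1" "r21 \<in> a2 \<inter> b1" "r31 \<noteq> 0" "r21 \<noteq> 0" "r21 = r31 + q1"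
    using scale_collinear_points[OF lines(2) points(8,1,6) _ _ _ _ _ _ q1] on_b1 by blast
  obtain r12 r32 where r2: "r12 \<in> a1 \<inter> b2" "r32 \<in> a3 \<inter> b2" "r12 \<noteq> 0" "r32 \<noteq> 0" "r32 = r12 + q2"
    using scale_collinear_points[OF lines(3) points(4,2,9) _ _ _ _ _ _ q23(1,3)] on_b2 by blast
  obtain r23 r13 where r3: "r23 \<in> a2 \<inter> b3" "r13 \<in> a1 \<inter> b3" "r23 \<noteq> 0" "r13 \<noteq> 0" "r13 = r23 + q3"
    using scale_collinear_points[OF lines(4) points(7,3,5) _ _ _ _ _ _ q3(1,2)] on_b3 by blast
  have q1_eq: "q1 = - q2 - q3"
    using q3(3) by (simp add: algebra_simps eq_neg_iff_add_eq_0)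
  \<comment> \<open>The same vectors in terms of the given points of one direction.\<close>
  have other: "r12 - r13 = q1 - r23 + r32" "r23 - r21 = q2 + r13 - r31" "r31 - r32 = q3 - r12 + r21"
    unfolding r1(5) r2(5) r3(5) q1_eq by simp_all
  show ?thesis
  proof
    show "(r12 - r13) + (r23 - r21) + (r31 - r32) = 0"
      unfolding r1(5) r2(5) r3(5) q1_eq by simp
    show "r12 - r13 \<in> a1" "r23 - r21 \<in> a2" "r31 - r32 \<in> a3"
      using lines r1 r2 r3 by (auto simp: proj_line_def vec.subspace_diff)
    show "r12 - r13 \<noteq> 0"
      using distinct_proj_points_disjoint[OF points(4,5) on_a(1)] r2(1,3) r3(2) by auto
    show "r23 - r21 \<noteq> 0"
      using distinct_proj_points_disjoint[OF points(6,7) on_a(2)] r1(2,4) r3(1) by auto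
    show "r31 - r32 \<noteq> 0"
      using distinct_proj_points_disjoint[OF points(8,9) on_a(3)] r1(1,3) r2(2) by auto
    show "r12 - r13 \<in> vec.span ((b1 \<inter> c) \<union> (a2 \<inter> b3) \<union> (a3 \<inter> b2))"
      unfolding other(1) using q1 r3(1) r2(2)
      by (intro vec.span_add vec.span_diff vec.span_base) auto
    show "r23 - r21 \<in> vec.span ((b2 \<inter> c) \<union> (a1 \<inter> b3) \<union> (a3 \<inter> b1))"
      unfolding other(2) using q23(1) r3(2) r1(1)
      by (intro vec.span_add vec.span_diff vec.span_base) auto
    show "r31 - r32 \<in> vec.span ((b3 \<inter> c) \<union> (a1 \<inter> b2) \<union> (a2 \<inter> b1))"
      unfolding other(3) using q3(1) r2(1) r1(2)
      by (intro vec.span_add vec.span_diff vec.span_base) auto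
  qed
qed

text \<open>
  Coplanarity in direction \<open>i\<close> forces the eighth line to meet \<open>a i\<close> exactly in the trace of the
  plane of direction \<open>i\<close>, which is the point \<open>p i\<close>. Because the \<open>a i\<close> are skew these points are
  different, so two of them determine the line, and the collinearity assumption is what remains
  for its existence. Skewness also ensures that the line differs from every \<open>a i\<close>, so that it
  meets each of them in a single point.
\<close>

lemma eighth_line_through_fourth_points:
  assumes lines: "\<And>i. i \<in> I \<Longrightarrow> proj_line (a i)"
    and skew: "\<And>i j. i \<in> I \<Longrightarrow> j \<in> I \<Longrightarrow> i \<noteq> j \<Longrightarrow> proj_skew (a i) (a j)"
    and planes: "\<And>i. i \<in> I \<Longrightarrow> \<exists>!E. proj_plane E \<and> (\<forall>P\<in>X i. P \<subseteq> E)"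
    and off: "\<And>i E. i \<in> I \<Longrightarrow> proj_plane E \<Longrightarrow> \<forall>P\<in>X i. P \<subseteq> E \<Longrightarrow> \<not> a i \<subseteq> E"
    and p: "\<And>i. i \<in> I \<Longrightarrow> p i \<in> a i \<and> p i \<noteq> 0 \<and> p i \<in> vec.span (\<Union>(X i))"
    and two: "j \<in> I" "k \<in> I" "j \<noteq> k"
    and collinear: "\<And>i. i \<in> I \<Longrightarrow> p i \<in> vec.span {p j, p k}"
  shows "\<exists>!K. proj_line K \<and>
    (\<forall>i\<in>I. proj_point (K \<inter> a i) \<and> proj_coplanar (insert (K \<inter> a i) (X i)))"
proof -
  let ?K = "vec.span {p j, p k}"
  have sub: "vec.subspace (a i)" if "i \<in> I" for i
    using lines[OF that] by (simp add: proj_line_def)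
  have apart: "p i \<notin> a l" if "i \<in> I" "l \<in> I" "i \<noteq> l" for i l
    using that skew[of i l] p[of i] sub proj_intersectI[of "a i" "a l" "p i"]
    by (auto simp: proj_skew_def)
  have indep: "p j \<notin> vec.span {p k}"
    using apart[OF two] vec.span_minimal[of "{p k}" "a k"] p[of k] sub[of k] two by auto
  have K: "proj_line ?K"
    using indep p[of k] two by (simp add: proj_line_def vec.dim_insert)
  have in_plane: "p i \<in> E" if "i \<in> I" "proj_plane E" "\<forall>P\<in>X i. P \<subseteq> E" for i E
    using that p[of i] vec.span_minimal[of "\<Union>(X i)" E] by (auto simp: proj_plane_def)
  have fourth: "a i \<inter> E = vec.span {p i}"
    if "i \<in> I" "proj_plane E" "\<forall>P\<in>X i. P \<subseteq> E" for i E
    using that off[of i E] lines[of i] p[of i] in_plane[of i E] sub[of i]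
    by (intro proper_subspace_of_line[of "a i"]) (auto simp: proj_plane_def vec.subspace_inter)
  have meets: "?K \<inter> a i = vec.span {p i}" if i: "i \<in> I" for i
  proof -
    \<comment> \<open>A point of the line off \<open>a i\<close>; which of the two serves depends on \<open>i\<close>.\<close>
    obtain l where l: "l \<in> {j, k}" "l \<noteq> i" using two by blast
    then have "p l \<in> ?K" "p l \<notin> a i"
      using apart[of l i] i two by (auto simp: vec.span_base)
    then have "?K \<inter> a i \<noteq> ?K" by blast
    then show ?thesis
      using i p[of i] collinear[of i] sub[of i] K
      by (intro proper_subspace_of_line[of ?K]) (auto simp: vec.subspace_inter)
  qed
  show ?thesis
  proof (intro ex1I[of _ ?K] conjI ballI)
    show "proj_line ?K" by (fact K)
  next
    fix i assume i: "i \<in> I"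
    then show "proj_point (?K \<inter> a i)"
      using meets p[of i] by (simp add: proj_point_span)
    obtain E where E: "proj_plane E" "\<forall>P\<in>X i. P \<subseteq> E"
      using planes[OF i] by blast
    then show "proj_coplanar (insert (?K \<inter> a i) (X i))"
      unfolding proj_coplanar_def using fourth[OF i E] meets[OF i] by blast
  next
    fix K' assume K': "proj_line K' \<and>
      (\<forall>i\<in>I. proj_point (K' \<inter> a i) \<and> proj_coplanar (insert (K' \<inter> a i) (X i)))"
    have on: "p i \<in> K'" if i: "i \<in> I" for i
    proof -
      have pt: "proj_point (K' \<inter> a i)" using K' i by blast
      have "proj_coplanar (insert (K' \<inter> a i) (X i))" using K' i by blast
      then obtain E where E: "proj_plane E" "\<forall>P\<in>X i. P \<subseteq> E" "K' \<inter> a i \<subseteq> E"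
        unfolding proj_coplanar_def by auto
      obtain x where x: "x \<in> K' \<inter> a i" "x \<noteq> 0"
        using pt proj_point_nonzero by blast
      then have "x \<in> vec.span {p i}"
        using fourth[OF i E(1,2)] E(3) by blast
      then have "K' \<inter> a i = vec.span {p i}"
        using distinct_proj_points_disjoint[OF pt proj_point_span] x p[OF i] by blast
      then show ?thesis using vec.span_base[of "p i" "{p i}"] by blast
    qed
    show "K' = ?K"
      using K' on two p[of k] indep by (intro proj_line_eq_span) auto
  qed
qed

section \<open>Directions and symmetries of the cube\<close>

lemma cube_edge_iff:
  "cube_edge A B \<longleftrightarrow> A \<in> cube_vertices \<and> (\<exists>i\<in>{1, 2, 3}. B = opposite_end A i)"
proof
  assume e: "cube_edge A B"
  then have "card (sym_diff A B) = 1" by (simp only: cube_edge_def)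
  then obtain i where i: "sym_diff A B = {i}" by (rule card_1_singletonE)
  then have "i \<in> {1, 2, 3}" using e by (auto simp: cube_edge_def)
  moreover have "B = opposite_end A i"
  proof (rule set_eqI)
    fix x
    have "x \<in> B \<longleftrightarrow> (x \<in> A) \<noteq> (x = i)" using i by blast
    then show "x \<in> B \<longleftrightarrow> x \<in> opposite_end A i" by (cases "x = i") (simp_all add: opposite_end_def)
  qed
  ultimately show "A \<in> cube_vertices \<and> (\<exists>i\<in>{1, 2, 3}. B = opposite_end A i)"
    using e by (auto simp: cube_edge_def)
next
  assume "A \<in> cube_vertices \<and> (\<exists>i\<in>{1, 2, 3}. B = opposite_end A i)"
  then obtain i where i: "i \<in> {1, 2, 3}" "B = opposite_end A i" "A \<in> cube_vertices" by blast
  then have "sym_diff A B = {i}" by (auto simp: opposite_end_def)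
  then show "cube_edge A B" using i by (auto simp: cube_edge_def opposite_end_def)
qed

text \<open>
  An edge of direction \<open>i\<close> may be named by either of its endpoints. The description on the right,
  which does not prefer the endpoint without \<open>i\<close>, is invariant under the automorphisms of the
  cube that preserve directions.
\<close>

lemma edge_pts_of_direction:
  assumes "i \<in> {1, 2, 3}"
  shows "{edge_pt L i S | S. S \<subseteq> {1, 2, 3} - {i} \<and> P S \<and> P (insert i S)} =
    {L A \<inter> L (opposite_end A i) | A. A \<in> cube_vertices \<and> P A \<and> P (opposite_end A i)}"
    (is "?lhs = ?rhs")
proof (intro equalityI subsetI)
  fix x assume "x \<in> ?lhs"
  then obtain S where S: "x = edge_pt L i S" "S \<subseteq> {1, 2, 3} - {i}" "P S" "P (insert i S)" by blast
  then have "opposite_end S i = insert i S" by (auto simp: opposite_end_def)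
  then show "x \<in> ?rhs" using S by (auto simp: edge_pt_def intro!: exI[of _ S])
next
  fix x assume "x \<in> ?rhs"
  then obtain A where A: "x = L A \<inter> L (opposite_end A i)" "A \<in> cube_vertices" "P A" "P (opposite_end A i)"
    by blast
  then have "x = edge_pt L i (A - {i})" "P (A - {i})" "P (insert i (A - {i}))"
    by (auto simp: edge_pt_def opposite_end_def insert_absorb split: if_splits)
  moreover have "A - {i} \<subseteq> {1, 2, 3} - {i}" using A by auto
  ultimately show "x \<in> ?lhs" by blast
qed

lemma given_pts_opposite:
  "i \<in> {1, 2, 3} \<Longrightarrow> given_pts L v i =
    {L A \<inter> L (opposite_end A i) | A. A \<in> cube_vertices \<and> A \<noteq> v \<and> opposite_end A i \<noteq> v}"
  unfolding given_pts_def using edge_pts_of_direction[of i L "\<lambda>S. S \<noteq> v"] by simp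

lemma Pow_two: "Pow {m, p} = {{}, {m}, {m, p}, {p}}"
  by (auto simp: Pow_insert)

lemma remaining_directions:
  assumes "l \<in> {1, 2, 3}" "m \<in> {1, 2, 3}" "p \<in> {1, 2, 3::nat}" "l \<noteq> m" "l \<noteq> p" "m \<noteq> p"
  shows "{1, 2, 3} - {l} = {m, p}"
  using assms by auto

lemma parallel_edge_pts:
  assumes "l \<in> {1, 2, 3}" "m \<in> {1, 2, 3}" "p \<in> {1, 2, 3::nat}" "l \<noteq> m" "l \<noteq> p" "m \<noteq> p"
  shows "{edge_pt L l {}, edge_pt L l {m}, edge_pt L l {m, p}, edge_pt L l {p}} =
    {L A \<inter> L (opposite_end A l) | A. A \<in> cube_vertices}"
proof -
  have "{edge_pt L l {}, edge_pt L l {m}, edge_pt L l {m, p}, edge_pt L l {p}} =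
      edge_pt L l ` Pow ({1, 2, 3} - {l})"
    unfolding remaining_directions[OF assms] Pow_two by simp
  also have "\<dots> = {edge_pt L l S | S. S \<subseteq> {1, 2, 3} - {l} \<and> True \<and> True}"
    by blast
  also have "\<dots> = {L A \<inter> L (opposite_end A l) | A. A \<in> cube_vertices}"
    unfolding edge_pts_of_direction[OF assms(1), where P = "\<lambda>_. True"] by simp
  finally show ?thesis .
qed

lemma other_directions:
  assumes "i \<in> {1, 2, 3::nat}"
  obtains m p where "m \<in> {1, 2, 3}" "p \<in> {1, 2, 3::nat}" "i \<noteq> m" "i \<noteq> p" "m \<noteq> p"
proof -
  consider "i = 1" | "i = 2" | "i = 3" using assms by blast
  then show ?thesis
    by cases (rule that[of 2 3], simp_all, rule that[of 1 3], simp_all, rule that[of 1 2], simp_all)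
qed

text \<open>
  The four points of a coplanarity condition lie on all the edges of one direction, so ordered
  triples with the same first entry state the same condition.
\<close>

lemma fundamental_cube_iff_directions:
  "fundamental_cube L \<longleftrightarrow>
     (\<forall>A\<in>cube_vertices. proj_line (L A)) \<and>
     (\<forall>A B. cube_edge A B \<longrightarrow> proj_point (L A \<inter> L B)) \<and>
     (\<forall>i\<in>{1, 2, 3}. proj_coplanar {L A \<inter> L (opposite_end A i) | A. A \<in> cube_vertices})"
proof -
  have "(\<forall>l\<in>{1, 2, 3}. \<forall>m\<in>{1, 2, 3}. \<forall>p\<in>{1, 2, 3}. l \<noteq> m \<and> l \<noteq> p \<and> m \<noteq> p \<longrightarrow>
        proj_coplanar {edge_pt L l {}, edge_pt L l {m}, edge_pt L l {m, p}, edge_pt L l {p}}) \<longleftrightarrow>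
      (\<forall>i\<in>{1, 2, 3}. proj_coplanar {L A \<inter> L (opposite_end A i) | A. A \<in> cube_vertices})"
    (is "?faces \<longleftrightarrow> ?dirs")
  proof (intro iffI ballI impI)
    fix i :: nat assume ?faces and i: "i \<in> {1, 2, 3}"
    obtain m p where mp: "m \<in> {1, 2, 3}" "p \<in> {1, 2, 3::nat}" "i \<noteq> m" "i \<noteq> p" "m \<noteq> p"
      by (rule other_directions[OF i])
    then have "proj_coplanar {edge_pt L i {}, edge_pt L i {m}, edge_pt L i {m, p}, edge_pt L i {p}}"
      using \<open>?faces\<close> i by blast
    then show "proj_coplanar {L A \<inter> L (opposite_end A i) | A. A \<in> cube_vertices}"
      unfolding parallel_edge_pts[OF i mp] .
  next
    fix l m p :: nat
    assume "?dirs" and l: "l \<in> {1, 2, 3}" "m \<in> {1, 2, 3}" "p \<in> {1, 2, 3}"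
      and ne: "l \<noteq> m \<and> l \<noteq> p \<and> m \<noteq> p"
    then have "proj_coplanar {L A \<inter> L (opposite_end A l) | A. A \<in> cube_vertices}"
      by (elim bspec)
    then show "proj_coplanar {edge_pt L l {}, edge_pt L l {m}, edge_pt L l {m, p}, edge_pt L l {p}}"
      using parallel_edge_pts[OF l, of L] ne by simp
  qed
  then show ?thesis
    unfolding fundamental_cube_def by simp
qed

text \<open>
  The automorphism of the cube that takes \<open>{}\<close> to \<open>v\<close> and preserves the direction of every edge.
  It reduces the theorem to the case in which the line at the vertex \<open>{}\<close> is missing.
\<close>

definition relabel :: "nat set \<Rightarrow> nat set \<Rightarrow> nat set" where
  "relabel v A = sym_diff v A"

lemma mem_relabel: "x \<in> relabel v A \<longleftrightarrow> (x \<in> v) \<noteq> (x \<in> A)"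
  by (auto simp: relabel_def)

lemma mem_opposite_end: "x \<in> opposite_end A i \<longleftrightarrow> (x \<in> A) \<noteq> (x = i)"
  by (cases "x = i") (simp_all add: opposite_end_def)

lemma relabel_relabel: "relabel v (relabel v A) = A"
  by (rule set_eqI) (simp add: mem_relabel, blast)

lemma opposite_end_relabel: "opposite_end (relabel v A) i = relabel v (opposite_end A i)"
  by (rule set_eqI) (simp add: mem_relabel mem_opposite_end, blast)

lemma relabel_empty: "relabel v {} = v"
  by (simp add: relabel_def)

lemma relabel_eq_iff: "relabel v A = relabel v B \<longleftrightarrow> A = B"
  using relabel_relabel by metis

lemma relabel_eq_centre: "relabel v A = v \<longleftrightarrow> A = {}"
  using relabel_eq_iff[of v A "{}"] by (simp add: relabel_empty)

lemma relabel_vertex: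
  assumes "v \<in> cube_vertices"
  shows "relabel v A \<in> cube_vertices \<longleftrightarrow> A \<in> cube_vertices"
proof -
  have "relabel v B \<in> cube_vertices" if "B \<in> cube_vertices" for B
    using assms that unfolding relabel_def by blast
  then show ?thesis using relabel_relabel by metis
qed

lemmas relabel_simps = opposite_end_relabel relabel_eq_iff relabel_eq_centre relabel_vertex

lemma cube_edge_relabel:
  assumes "v \<in> cube_vertices"
  shows "cube_edge (relabel v A) (relabel v B) \<longleftrightarrow> cube_edge A B"
  unfolding cube_edge_iff by (simp only: relabel_simps assms)

lemma all_relabel: "(\<forall>A. P (relabel v A)) \<longleftrightarrow> (\<forall>A. P A)"
proof (intro iffI allI)
  fix A assume "\<forall>A. P (relabel v A)"
  then have "P (relabel v (relabel v A))" by (rule spec)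
  then show "P A" by (simp only: relabel_relabel)
qed (rule spec)

lemma Collect_relabel: "{f (relabel v A) | A. P (relabel v A)} = {f A | A. P A}"
proof -
  have "(\<exists>A. x = f (relabel v A) \<and> P (relabel v A)) \<longleftrightarrow> (\<exists>A. x = f A \<and> P A)" for x
    using all_relabel[of "\<lambda>A. \<not> (x = f A \<and> P A)" v] by blast
  then show ?thesis by simp
qed

lemma parallel_edge_pts_relabel:
  assumes "v \<in> cube_vertices"
  shows "{L (relabel v A) \<inter> L (relabel v (opposite_end A i)) | A. A \<in> cube_vertices} =
    {L A \<inter> L (opposite_end A i) | A. A \<in> cube_vertices}"
  using Collect_relabel[of "\<lambda>A. L A \<inter> L (opposite_end A i)" v "\<lambda>A. A \<in> cube_vertices"]
  by (simp only: relabel_simps assms)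

lemma fundamental_cube_relabel:
  assumes "v \<in> cube_vertices"
  shows "fundamental_cube (\<lambda>A. L (relabel v A)) \<longleftrightarrow> fundamental_cube L"
proof -
  have "(\<forall>A\<in>cube_vertices. proj_line (L (relabel v A))) \<longleftrightarrow> (\<forall>A\<in>cube_vertices. proj_line (L A))"
    using all_relabel[of "\<lambda>A. A \<in> cube_vertices \<longrightarrow> proj_line (L A)" v]
    by (simp only: Ball_def relabel_simps assms)
  moreover have "(\<forall>A B. cube_edge A B \<longrightarrow> proj_point (L (relabel v A) \<inter> L (relabel v B))) \<longleftrightarrow>
      (\<forall>A B. cube_edge A B \<longrightarrow> proj_point (L A \<inter> L B))"
    using all_relabel[of "\<lambda>A. \<forall>B. cube_edge A B \<longrightarrow> proj_point (L A \<inter> L B)" v]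
      all_relabel[of "\<lambda>B. cube_edge (relabel v _) B \<longrightarrow> proj_point (L (relabel v _) \<inter> L B)" v]
    by (simp only: cube_edge_relabel[OF assms])
  ultimately show ?thesis
    unfolding fundamental_cube_iff_directions by (simp only: parallel_edge_pts_relabel[OF assms])
qed

lemma given_pts_relabel:
  assumes "v \<in> cube_vertices" "i \<in> {1, 2, 3}"
  shows "given_pts (\<lambda>A. L (relabel v A)) {} i = given_pts L v i"
  unfolding given_pts_opposite[OF assms(2)]
  using Collect_relabel[of "\<lambda>A. L A \<inter> L (opposite_end A i)" v
      "\<lambda>A. A \<in> cube_vertices \<and> A \<noteq> v \<and> opposite_end A i \<noteq> v"]
  by (simp only: relabel_simps assms)

lemma general_position_relabel:
  assumes v: "v \<in> cube_vertices" and gp: "general_position L v"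
  shows "general_position (\<lambda>A. L (relabel v A)) {}"
proof -
  have opp: "relabel v (opposite_end {} i) = opposite_end v i" for i
    using opposite_end_relabel[of v "{}" i] by (simp add: relabel_empty)
  note gp = gp[unfolded general_position_def]
  have edges: "L (relabel v A) \<noteq> L (relabel v B) \<and> proj_point (L (relabel v A) \<inter> L (relabel v B))"
    if "cube_edge A B \<and> A \<noteq> {} \<and> B \<noteq> {}" for A B
    using gp[THEN conjunct1, rule_format, of "relabel v A" "relabel v B"] that
    by (simp only: relabel_simps cube_edge_relabel v not_False_eq_True simp_thms)
  have pts: "L (relabel v A) \<inter> L (relabel v B) \<noteq> L (relabel v A) \<inter> L (relabel v C)"
    if "cube_edge A B \<and> cube_edge A C \<and> B \<noteq> C \<and> A \<noteq> {} \<and> B \<noteq> {} \<and> C \<noteq> {}" for A B C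
    using gp[THEN conjunct2, THEN conjunct1, rule_format,
        of "relabel v A" "relabel v B" "relabel v C"] that
    by (simp only: relabel_simps cube_edge_relabel v simp_thms)
  have skew: "proj_skew (L (relabel v A)) (L (relabel v B))"
    if "A \<in> cube_vertices - {{}}" "B \<in> cube_vertices - {{}}" "A \<noteq> B \<and> \<not> cube_edge A B" for A B
    using gp[THEN conjunct2, THEN conjunct2, THEN conjunct1, rule_format,
        of "relabel v A" "relabel v B"] that
    by (simp only: relabel_simps cube_edge_relabel v simp_thms Diff_iff singleton_iff)
  have directions: "\<forall>i\<in>{1, 2, 3}. \<not> proj_collinear (given_pts (\<lambda>A. L (relabel v A)) {} i) \<and>
      (\<forall>E. proj_plane E \<and> (\<forall>P\<in>given_pts (\<lambda>A. L (relabel v A)) {} i. P \<subseteq> E) \<longrightarrow>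
        \<not> L (opposite_end v i) \<subseteq> E)"
  proof
    fix i :: nat assume i: "i \<in> {1, 2, 3}"
    show "\<not> proj_collinear (given_pts (\<lambda>A. L (relabel v A)) {} i) \<and>
      (\<forall>E. proj_plane E \<and> (\<forall>P\<in>given_pts (\<lambda>A. L (relabel v A)) {} i. P \<subseteq> E) \<longrightarrow>
        \<not> L (opposite_end v i) \<subseteq> E)"
      unfolding given_pts_relabel[OF v i]
      by (rule bspec[OF gp[THEN conjunct2, THEN conjunct2, THEN conjunct2] i])
  qed
  show ?thesis
    unfolding general_position_def opp
    using edges pts skew by (intro conjI directions; intro allI ballI impI)
qed

lemma given_pts_empty:
  assumes "l \<in> {1, 2, 3}" "m \<in> {1, 2, 3}" "p \<in> {1, 2, 3::nat}" "l \<noteq> m" "l \<noteq> p" "m \<noteq> p"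
  shows "given_pts L {} l = {edge_pt L l {m}, edge_pt L l {m, p}, edge_pt L l {p}}"
proof -
  have "given_pts L {} l = edge_pt L l ` (Pow ({1, 2, 3} - {l}) - {{}})"
    unfolding given_pts_def by blast
  also have "Pow ({1, 2, 3} - {l}) - {{}} = {{m}, {m, p}, {p}}"
    unfolding remaining_directions[OF assms] Pow_two by auto
  finally show ?thesis by simp
qed

text \<open>
  Incidences among the given lines hold already, so only three intersections and three coplanarity
  conditions restrict the missing line.
\<close>

lemma fundamental_cube_eighth:
  assumes lines: "\<And>A. A \<in> cube_vertices - {{}} \<Longrightarrow> proj_line (N A)"
    and points: "\<And>A B. cube_edge A B \<Longrightarrow> A \<noteq> {} \<Longrightarrow> B \<noteq> {} \<Longrightarrow> proj_point (N A \<inter> N B)"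
  shows "fundamental_cube (N({} := K)) \<longleftrightarrow> proj_line K \<and>
    (\<forall>i\<in>{1, 2, 3}. proj_point (K \<inter> N {i}) \<and>
       proj_coplanar (insert (K \<inter> N {i}) (given_pts N {} i)))"
proof -
  let ?M = "N({} := K)"
  have "cube_vertices = insert {} (cube_vertices - {{}})" by blast
  then have 1: "(\<forall>A\<in>cube_vertices. proj_line (?M A)) \<longleftrightarrow> proj_line K"
    using lines by (metis (no_types, lifting) Diff_iff fun_upd_apply insert_iff)
  have edge: "cube_edge {} B \<longleftrightarrow> (\<exists>i\<in>{1, 2, 3}. B = {i})"
    "cube_edge B {} \<longleftrightarrow> (\<exists>i\<in>{1, 2, 3}. B = {i})" for B
    by (auto simp: cube_edge_def card_1_singleton_iff)
  have 2: "(\<forall>A B. cube_edge A B \<longrightarrow> proj_point (?M A \<inter> ?M B)) \<longleftrightarrow>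
      (\<forall>i\<in>{1, 2, 3}. proj_point (K \<inter> N {i}))" (is "?l \<longleftrightarrow> ?r")
  proof
    assume l: ?l
    show ?r
    proof
      fix i :: nat assume "i \<in> {1, 2, 3}"
      then have "cube_edge {} {i}" using edge(1) by blast
      then have "proj_point (?M {} \<inter> ?M {i})" using l by blast
      then show "proj_point (K \<inter> N {i})" by simp
    qed
  next
    assume r: ?r
    show ?l
    proof (intro allI impI)
      fix A B assume AB: "cube_edge A B"
      show "proj_point (?M A \<inter> ?M B)"
      proof (cases "A = {}")
        case True
        then obtain i where "i \<in> {1, 2, 3}" "B = {i}"
          using AB edge(1)[of B] by blast
        then show ?thesis using bspec[OF r, of i] True by simp
      next
        case A: False
        show ?thesis
        proof (cases "B = {}")
          case True
          then obtain i where "i \<in> {1, 2, 3}" "A = {i}"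
            using AB edge(2)[of A] by blast
          then show ?thesis using bspec[OF r, of i] True by (simp add: Int_commute)
        next
          case False
          then show ?thesis using points[OF AB] A by simp
        qed
      qed
    qed
  qed
  have 3: "{edge_pt ?M l {}, edge_pt ?M l {m}, edge_pt ?M l {m, p}, edge_pt ?M l {p}} =
      insert (K \<inter> N {l}) (given_pts N {} l)"
    if "l \<in> {1, 2, 3}" "m \<in> {1, 2, 3}" "p \<in> {1, 2, 3::nat}" "l \<noteq> m" "l \<noteq> p" "m \<noteq> p" for l m p
    unfolding given_pts_empty[OF that] by (simp add: edge_pt_def)
  have "{?M A \<inter> ?M (opposite_end A i) | A. A \<in> cube_vertices} =
      insert (K \<inter> N {i}) (given_pts N {} i)" if i: "i \<in> {1, 2, 3}" for i
  proof -
    obtain m p where mp: "m \<in> {1, 2, 3}" "p \<in> {1, 2, 3::nat}" "i \<noteq> m" "i \<noteq> p" "m \<noteq> p"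
      by (rule other_directions[OF i])
    show ?thesis
      using 3[OF i mp] parallel_edge_pts[OF i mp, of ?M] by simp
  qed
  then show ?thesis
    unfolding fundamental_cube_iff_directions 1 2 ball_conj_distrib by (simp only: cong: ball_cong)
qed

section \<open>The eighth line of the cube\<close>

lemma eighth_line_at_empty:
  assumes lines: "\<And>A. A \<in> cube_vertices - {{}} \<Longrightarrow> proj_line (N A)"
    and gp: "general_position N {}"
  shows "\<exists>!K. proj_line K \<and> fundamental_cube (N({} := K))"
proof -
  note gp = gp[unfolded general_position_def]
  have points: "proj_point (N A \<inter> N B)" if "cube_edge A B" "A \<noteq> {}" "B \<noteq> {}" for A B
    using gp[THEN conjunct1, rule_format, of A B] that by simp
  have distinct: "N A \<inter> N B \<noteq> N A \<inter> N C" "N B \<inter> N A \<noteq> N C \<inter> N A" "N A \<inter> N B \<noteq> N C \<inter> N A"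
    if "cube_edge A B" "cube_edge A C" "B \<noteq> C" "A \<noteq> {}" "B \<noteq> {}" "C \<noteq> {}" for A B C
    using gp[THEN conjunct2, THEN conjunct1, rule_format, of A B C] that
    by (simp_all add: Int_commute)
  \<comment> \<open>Every edge occurs in both orders, because the comparison of two points of a line below names
    the vertex of that line first.\<close>
  have edges: "cube_edge {1, 2, 3} {2, 3}" "cube_edge {1, 2, 3} {1, 3}" "cube_edge {1, 2, 3} {1, 2}"
    "cube_edge {2, 3} {1, 2, 3}" "cube_edge {1, 3} {1, 2, 3}" "cube_edge {1, 2} {1, 2, 3}"
    "cube_edge {1} {1, 3}" "cube_edge {1} {1, 2}" "cube_edge {2} {2, 3}"
    "cube_edge {2} {1, 2}" "cube_edge {3} {2, 3}" "cube_edge {3} {1, 3}"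
    "cube_edge {1, 3} {1}" "cube_edge {1, 2} {1}" "cube_edge {2, 3} {2}"
    "cube_edge {1, 2} {2}" "cube_edge {2, 3} {3}" "cube_edge {1, 3} {3}"
    by (simp_all add: cube_edge_def insert_Diff_if)
  have vertices_distinct: "{2, 3} \<noteq> {1, 3::nat}" "{2, 3} \<noteq> {1, 2::nat}" "{1, 3} \<noteq> {1, 2::nat}"
    "{1, 2, 3} \<noteq> {1::nat}" "{1, 2, 3} \<noteq> {2::nat}" "{1, 2, 3} \<noteq> {3::nat}"
    "{1} \<noteq> {2::nat}" "{1} \<noteq> {3::nat}" "{2} \<noteq> {3::nat}"
    by (simp_all add: doubleton_eq_iff)
  \<comment> \<open>Here \<open>c\<close> is \<open>N {1, 2, 3}\<close>, \<open>a\<^sub>i\<close> is \<open>N {i}\<close>, and \<open>b\<^sub>k\<close> belongs to the two-element set without \<open>k\<close>.\<close>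
  have L: "proj_line (N {1, 2, 3})" "proj_line (N {2, 3})" "proj_line (N {1, 3})"
    "proj_line (N {1, 2})" "proj_line (N {1})" "proj_line (N {2})" "proj_line (N {3})"
    by (rule lines; simp)+
  have P: "proj_point (N {2, 3} \<inter> N {1, 2, 3})" "proj_point (N {1, 3} \<inter> N {1, 2, 3})"
    "proj_point (N {1, 2} \<inter> N {1, 2, 3})" "proj_point (N {1} \<inter> N {1, 3})"
    "proj_point (N {1} \<inter> N {1, 2})" "proj_point (N {2} \<inter> N {2, 3})"
    "proj_point (N {2} \<inter> N {1, 2})" "proj_point (N {3} \<inter> N {2, 3})"
    "proj_point (N {3} \<inter> N {1, 3})"
    by (rule points; (rule edges)?; simp)+
  have C: "N {2, 3} \<inter> N {1, 2, 3} \<noteq> N {1, 3} \<inter> N {1, 2, 3}"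
    "N {2, 3} \<inter> N {1, 2, 3} \<noteq> N {1, 2} \<inter> N {1, 2, 3}"
    "N {1, 3} \<inter> N {1, 2, 3} \<noteq> N {1, 2} \<inter> N {1, 2, 3}"
    by (rule distinct(2); (rule edges vertices_distinct insert_not_empty)+)+
  have B1: "N {2, 3} \<inter> N {1, 2, 3} \<noteq> N {2} \<inter> N {2, 3}"
    "N {2, 3} \<inter> N {1, 2, 3} \<noteq> N {3} \<inter> N {2, 3}" "N {2} \<inter> N {2, 3} \<noteq> N {3} \<inter> N {2, 3}"
    by (rule distinct(2,3); (rule edges vertices_distinct insert_not_empty)+)+
  have B2: "N {1, 3} \<inter> N {1, 2, 3} \<noteq> N {1} \<inter> N {1, 3}"
    "N {1, 3} \<inter> N {1, 2, 3} \<noteq> N {3} \<inter> N {1, 3}" "N {1} \<inter> N {1, 3} \<noteq> N {3} \<inter> N {1, 3}"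
    by (rule distinct(2,3); (rule edges vertices_distinct insert_not_empty)+)+
  have B3: "N {1, 2} \<inter> N {1, 2, 3} \<noteq> N {1} \<inter> N {1, 2}"
    "N {1, 2} \<inter> N {1, 2, 3} \<noteq> N {2} \<inter> N {1, 2}" "N {1} \<inter> N {1, 2} \<noteq> N {2} \<inter> N {1, 2}"
    by (rule distinct(2,3); (rule edges vertices_distinct insert_not_empty)+)+
  have A: "N {1} \<inter> N {1, 3} \<noteq> N {1} \<inter> N {1, 2}" "N {2} \<inter> N {2, 3} \<noteq> N {2} \<inter> N {1, 2}"
    "N {3} \<inter> N {2, 3} \<noteq> N {3} \<inter> N {1, 3}"
    by (rule distinct(1); (rule edges vertices_distinct insert_not_empty)+)+
  obtain p1 p2 p3 where sum: "p1 + p2 + p3 = 0"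
    and p1: "p1 \<in> N {1}" "p1 \<noteq> 0"
      "p1 \<in> vec.span ((N {2, 3} \<inter> N {1, 2, 3}) \<union> (N {2} \<inter> N {1, 2}) \<union> (N {3} \<inter> N {1, 3}))"
    and p2: "p2 \<in> N {2}" "p2 \<noteq> 0"
      "p2 \<in> vec.span ((N {1, 3} \<inter> N {1, 2, 3}) \<union> (N {1} \<inter> N {1, 2}) \<union> (N {3} \<inter> N {2, 3}))"
    and p3: "p3 \<in> N {3}" "p3 \<noteq> 0"
      "p3 \<in> vec.span ((N {1, 2} \<inter> N {1, 2, 3}) \<union> (N {1} \<inter> N {1, 3}) \<union> (N {2} \<inter> N {2, 3}))"
    by (rule fourth_points_sum_to_zero[OF L P C B1 B2 B3 A])
  have given: "given_pts N {} 1 = {N {2, 3} \<inter> N {1, 2, 3}, N {2} \<inter> N {1, 2}, N {3} \<inter> N {1, 3}}"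
    "given_pts N {} 2 = {N {1, 3} \<inter> N {1, 2, 3}, N {1} \<inter> N {1, 2}, N {3} \<inter> N {2, 3}}"
    "given_pts N {} 3 = {N {1, 2} \<inter> N {1, 2, 3}, N {1} \<inter> N {1, 3}, N {2} \<inter> N {2, 3}}"
    using given_pts_empty[of 1 2 3 N] given_pts_empty[of 2 1 3 N] given_pts_empty[of 3 1 2 N]
    by (simp_all add: edge_pt_def insert_commute)
  have not_collinear: "\<not> proj_collinear (given_pts N {} i)" if "i \<in> {1, 2, 3}" for i
    using gp[THEN conjunct2, THEN conjunct2, THEN conjunct2, rule_format, OF that] by (rule conjunct1)
  have off: "\<not> N {i} \<subseteq> E"
    if "i \<in> {1, 2, 3}" "proj_plane E" "\<forall>P\<in>given_pts N {} i. P \<subseteq> E" for i E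
  proof -
    have "opposite_end {} i = {i}" by (simp add: opposite_end_def)
    then show ?thesis
      using gp[THEN conjunct2, THEN conjunct2, THEN conjunct2, THEN bspec, OF that(1)] that(2,3)
      by simp
  qed
  have skew: "proj_skew (N {i}) (N {j})" if "i \<in> {1, 2, 3}" "j \<in> {1, 2, 3}" "i \<noteq> j" for i j
  proof -
    have "{i} \<in> cube_vertices - {{}}" "{j} \<in> cube_vertices - {{}}" "{i} \<noteq> {j}"
      using that by blast+
    moreover have "\<not> cube_edge {i} {j}"
      using that(3) by (simp add: cube_edge_def insert_Diff_if)
    ultimately show ?thesis
      using gp[THEN conjunct2, THEN conjunct2, THEN conjunct1, THEN bspec, THEN bspec] by simp
  qed
  have planes: "\<exists>!E. proj_plane E \<and> (\<forall>P\<in>given_pts N {} i. P \<subseteq> E)" if i: "i \<in> {1, 2, 3}" for i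
  proof -
    consider "i = 1" | "i = 2" | "i = 3" using i by blast
    then show ?thesis
    proof cases
      case 1
      show ?thesis
        using not_collinear[OF i] unfolding 1 given by (rule unique_plane[OF P(1,7,9)])
    next
      case 2
      show ?thesis
        using not_collinear[OF i] unfolding 2 given by (rule unique_plane[OF P(2,5,8)])
    next
      case 3
      show ?thesis
        using not_collinear[OF i] unfolding 3 given by (rule unique_plane[OF P(3,4,6)])
    qed
  qed
  define p where "p i = (if i = 1 then p1 else if i = 2 then p2 else p3)" for i :: nat
  have p_simps: "p 1 = p1" "p 2 = p2" "p 3 = p3"
    by (simp_all add: p_def)
  have p: "p i \<in> N {i} \<and> p i \<noteq> 0 \<and> p i \<in> vec.span (\<Union>(given_pts N {} i))"
    if i: "i \<in> {1, 2, 3}" for i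
  proof -
    consider "i = 1" | "i = 2" | "i = 3" using i by blast
    then show ?thesis
      by cases (use p1 p2 p3 in \<open>simp_all only: p_simps given Union_insert Union_empty
        Un_empty_right Un_assoc simp_thms\<close>)
  qed
  have collinear: "p i \<in> vec.span {p 1, p 2}" if "i \<in> {1, 2, 3}" for i
  proof -
    have "p3 = - (p1 + p2)"
      using sum minus_unique[of "p1 + p2" p3] by simp
    then have "p3 \<in> vec.span {p1, p2}"
      by (simp only:) (intro vec.span_neg vec.span_add vec.span_base; simp)
    then have "{p1, p2, p3} \<subseteq> vec.span {p1, p2}"
      by (simp add: vec.span_base)
    moreover have "p i \<in> {p1, p2, p3}"
      by (simp add: p_def)
    ultimately show ?thesis
      unfolding p_simps by blast
  qed
  have "\<exists>!K. proj_line K \<and> (\<forall>i\<in>{1, 2, 3}. proj_point (K \<inter> N {i}) \<and>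
      proj_coplanar (insert (K \<inter> N {i}) (given_pts N {} i)))"
  proof (rule eighth_line_through_fourth_points[where p = p and j = 1 and k = 2])
    show "proj_line (N {i})" if "i \<in> {1, 2, 3}" for i
      using that by (intro lines) blast
  qed (use skew planes off p collinear in simp_all)
  then show ?thesis
    using fundamental_cube_eighth[of N, OF lines points] by auto
qed

theorem theorem4p8:
  fixes L :: "nat set \<Rightarrow> (complex^4) set" and v :: "nat set"
  assumes missing: "v \<in> cube_vertices"
    and lines: "\<And>A. A \<in> cube_vertices - {v} \<Longrightarrow> proj_line (L A)"
    and incident: "\<And>A B. cube_edge A B \<Longrightarrow> A \<noteq> v \<Longrightarrow> B \<noteq> v \<Longrightarrow> proj_intersect (L A) (L B)"
    and generic: "general_position L v"
  shows "\<exists>!K. proj_line K \<and> fundamental_cube (L(v := K))"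
proof -
  let ?N = "\<lambda>A. L (relabel v A)"
  have "proj_line (?N A)" if "A \<in> cube_vertices - {{}}" for A
  proof (rule lines)
    show "relabel v A \<in> cube_vertices - {v}"
      using that relabel_vertex[OF missing, of A] relabel_eq_centre[of v A] by blast
  qed
  then have "\<exists>!K. proj_line K \<and> fundamental_cube (?N({} := K))"
    using general_position_relabel[OF missing generic] by (rule eighth_line_at_empty)
  moreover have "?N({} := K) = (\<lambda>A. (L(v := K)) (relabel v A))" for K
    by (rule ext) (simp add: relabel_eq_centre)
  ultimately show ?thesis
    by (simp only: fundamental_cube_relabel[OF missing])
qed

end
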